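(* Let $G$ be a finite weighted directed graph with vertex set $V(G)=\{x_1,\ldots,x_r\}$, and let $L$ be the evolution operator of the evolution algebra $A(G)$ associated with $G$, with generators $e_1,\ldots,e_r$ corresponding to $x_1,\ldots,x_r$. For $n\ge 1$ and $1\le i\le r$ write $L^n(e_i)=n_{i1}e_1+n_{i2}e_2+\cdots+n_{ir}e_r$. Then, for all $i,j$, $n_{ij}$ coincides with the sum of the Markov weights of the walks of length $n$ from the vertex corresponding to $e_i$ to the vertex corresponding to $e_j$.
   Context: A weighted directed graph is a pair $G=(V(G),E(G))$ with directed edge set $E(G)\subseteq V(G)\times V(G)$ (loops allowed), together with a weight function $\omega:E(G)\to\mathbb{R}$. The associated evolution algebra $A(G)$ is the real algebra with basis (set of generators) $e_1,\ldots,e_r$ and products $e_i\cdot e_j=0$ for $i\neq j$ and $e_i^2=\sum_{k:(x_i,x_k)\in E(G)}\omega(x_i,x_k)\,e_k$. The evolution operator is the linear map $L:A(G)\to A(G)$ with $L(e_i)=e_i^2$ for all $i$, and $L^n$ is its $n$-fold composition. A walk of length $n$ from $u$ to $v$ is a sequence of vertices $u=v_0,v_1,\ldots,v_n=v$ such that each $(v_{t-1},v_t)$ is a directed edge (vertices and edges may repeat). The Markov weight of a walk is the product of the weights of its edges, counted with multiplicity. *)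

theory Defs
  imports "HOL-Analysis.Analysis" "Graph_Theory.Graph_Theory"
begin

text \<open>
  A weighted directed graph is a \<open>pair_pre_digraph\<close> \<open>G\<close>, whose arcs are pairs of vertices with
  loops allowed, together with a weight \<open>w\<close>. Only the values of \<open>w\<close> on the arcs of \<open>G\<close> are
  ever used.

  The vertices are enumerated by \<open>x\<close> on \<open>{1..r}\<close>. The algebra is the whole type \<open>'a\<close> with the
  product \<open>mul\<close>; since an evolution algebra is not associative in general, the product is an
  explicit bilinear map rather than a type class operation. Injectivity of \<open>e\<close> on \<open>{1..r}\<close> is
  needed because \<open>independent\<close> speaks about the set of generators only.
\<close>

definition evolution_algebra ::
    "'v pair_pre_digraph \<Rightarrow> ('v \<times> 'v \<Rightarrow> real) \<Rightarrow> nat \<Rightarrow> (nat \<Rightarrow> 'v)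
      \<Rightarrow> (nat \<Rightarrow> 'a::real_vector) \<Rightarrow> ('a \<Rightarrow> 'a \<Rightarrow> 'a) \<Rightarrow> bool" where
  "evolution_algebra G w r x e mul \<longleftrightarrow>
     bilinear mul \<and>
     inj_on e {1..r} \<and> independent (e ` {1..r}) \<and> span (e ` {1..r}) = UNIV \<and>
     (\<forall>i\<in>{1..r}. \<forall>j\<in>{1..r}. i \<noteq> j \<longrightarrow> mul (e i) (e j) = 0) \<and>
     (\<forall>i\<in>{1..r}. mul (e i) (e i) =
        (\<Sum>k \<in> {k \<in> {1..r}. (x i, x k) \<in> parcs G}. w (x i, x k) *\<^sub>R e k))"

definition evolution_operator ::
    "nat \<Rightarrow> (nat \<Rightarrow> 'a::real_vector) \<Rightarrow> ('a \<Rightarrow> 'a \<Rightarrow> 'a) \<Rightarrow> ('a \<Rightarrow> 'a) \<Rightarrow> bool" where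
  "evolution_operator r e mul L \<longleftrightarrow> linear L \<and> (\<forall>i\<in>{1..r}. L (e i) = mul (e i) (e i))"

definition walks :: "'v pair_pre_digraph \<Rightarrow> nat \<Rightarrow> 'v \<Rightarrow> 'v \<Rightarrow> 'v vwalk set" where
  "walks G n u v =
     {p. vwalk p (with_proj G) \<and> vwalk_length p = n \<and> hd p = u \<and> last p = v}"

definition markov_weight :: "('v \<times> 'v \<Rightarrow> real) \<Rightarrow> 'v vwalk \<Rightarrow> real" where
  "markov_weight w p = prod_list (map w (vwalk_arcs p))"

lemma finite_walks:
  assumes "pair_fin_digraph G"
  shows "finite (walks G n u v)"
proof (rule finite_subset)
  show "walks G n u v \<subseteq> {p. set p \<subseteq> pverts G \<and> length p = Suc n}"
    by (auto simp: walks_def vwalk_def neq_Nil_conv)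
  show "finite {p. set p \<subseteq> pverts G \<and> length p = Suc n}"
    using assms by (intro finite_lists_length_eq) (simp add: pair_fin_digraph.pair_finite_verts)
qed

text \<open>
  Every basis indexed by \<open>{1..r}\<close> carries an evolution algebra of the given graph, and every
  evolution algebra has exactly one evolution operator.
\<close>

lemma evolution_algebra_exists:
  fixes e :: "nat \<Rightarrow> 'a::real_vector"
  assumes "inj_on e {1..r}" "independent (e ` {1..r})" "span (e ` {1..r}) = UNIV"
  shows "\<exists>mul. evolution_algebra G w r x e mul"
proof -
  define c where "c i u = representation (e ` {1..r}) u (e i)" for i u
  define sq where
    "sq i = (\<Sum>k \<in> {k \<in> {1..r}. (x i, x k) \<in> parcs G}. w (x i, x k) *\<^sub>R e k)" for i
  define mul where "mul u v = (\<Sum>i\<in>{1..r}. (c i u * c i v) *\<^sub>R sq i)" for u v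
  have c_basis: "c i (e j) = (if i = j then 1 else 0)" if "i \<in> {1..r}" "j \<in> {1..r}" for i j
    using that assms by (auto simp: c_def representation_basis inj_on_eq_iff)
  have c_linear: "linear (c i)" for i
    unfolding c_def using assms(2,3)
    by (intro linearI) (simp_all add: representation_add representation_scale)
  have "linear (mul u)" "linear (\<lambda>u. mul u v)" for u v
    unfolding mul_def
    by (simp_all add: linear_iff linear_add[OF c_linear] linear_scale[OF c_linear] distrib_left
        distrib_right scaleR_add_left sum.distrib scaleR_sum_right mult.left_commute mult.assoc)
  then have "bilinear mul"
    by (simp add: bilinear_def)
  moreover have "mul (e i) (e j) = (if i = j then sq i else 0)"
    if "i \<in> {1..r}" "j \<in> {1..r}" for i j
  proof -
    have "mul (e i) (e j) = (\<Sum>k\<in>{1..r}. if k = i then (if i = j then sq i else 0) else 0)"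
      unfolding mul_def by (rule sum.cong) (use that in \<open>simp_all add: c_basis\<close>)
    then show ?thesis
      using that by simp
  qed
  ultimately have "evolution_algebra G w r x e mul"
    using assms by (simp add: evolution_algebra_def sq_def)
  then show ?thesis by blast
qed

lemma evolution_operator_exists_unique:
  assumes "evolution_algebra G w r x e mul"
  shows "\<exists>!L. evolution_operator r e mul L"
proof -
  have ind: "independent (e ` {1..r})"
    and span: "span (e ` {1..r}) = UNIV"
    using assms by (auto simp: evolution_algebra_def)
  obtain L where "linear L" "\<forall>b\<in>e ` {1..r}. L b = mul b b"
    using linear_independent_extend[OF ind, of "\<lambda>b. mul b b"] by blast
  then have "evolution_operator r e mul L"
    by (simp add: evolution_operator_def)
  moreover have "L' = L''"
    if "evolution_operator r e mul L'" "evolution_operator r e mul L''" for L' L''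
  proof
    fix v
    show "L' v = L'' v"
      by (rule linear_eq_on_span[of L' L'' "e ` {1..r}"])
        (use that in \<open>auto simp: evolution_operator_def span simp del: One_nat_def\<close>)
  qed
  ultimately show ?thesis by blast
qed

end

theory Submission
  imports Defs
begin

text \<open>
  Splitting a walk of length \<open>n + 1\<close> after its first arc turns the total Markov weight
  \<open>W\<^sub>n(u,v)\<close> of the walks of length \<open>n\<close> from \<open>u\<close> to \<open>v\<close> into the recursion
  \<open>W\<^sub>n\<^sub>+\<^sub>1(u,v) = (\<Sum>y. w(u,y) W\<^sub>n(y,v))\<close>, the sum ranging over the out-neighbours \<open>y\<close> of \<open>u\<close>
  (\<open>sum_markov_weight_walks_Suc\<close>). The images of the generators satisfy the same recursion,
  because \<open>L\<^sup>n\<close> is linear and \<open>L (e i) = (\<Sum>k. w(x i, x k) e k)\<close>, the sum ranging over the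
  arcs leaving \<open>x i\<close>. Both start from the identity matrix at \<open>n = 0\<close>, where the only walk is the
  trivial one and the empty product of weights is \<open>1\<close>; hence \<open>L\<^sup>n (e i)\<close> has coordinates
  \<open>W\<^sub>n(x i, x j)\<close> (\<open>evolution_operator_funpow\<close>). Coordinates with respect to a basis are unique,
  which identifies these numbers with the given coefficients.
\<close>

lemma walks_0: "walks G 0 u v = (if u = v \<and> u \<in> pverts G then {[u]} else {})"
proof -
  have "p \<in> walks G 0 u v \<longleftrightarrow> p = [u] \<and> u = v \<and> u \<in> pverts G" for p
    by (cases p) (auto simp: walks_def vwalk_def)
  then show ?thesis by auto
qed

text \<open>
  Well-formedness of the graph enters where an arc is put in front of a walk: its tail then is
  a vertex.
\<close>

lemma walks_Suc:
  assumes "pair_wf_digraph G"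
  shows "walks G (Suc n) u v = (\<Union>y\<in>{y. (u, y) \<in> parcs G}. (#) u ` walks G n y v)"
proof (intro set_eqI iffI)
  fix p
  assume "p \<in> walks G (Suc n) u v"
  then obtain y q where "p = u # y # q" "vwalk (u # y # q) (with_proj G)"
      "length q = n" "last (y # q) = v"
    by (cases p; cases "tl p") (auto simp: walks_def)
  then show "p \<in> (\<Union>y\<in>{y. (u, y) \<in> parcs G}. (#) u ` walks G n y v)"
    by (auto simp: walks_def vwalk_def)
next
  fix p
  assume "p \<in> (\<Union>y\<in>{y. (u, y) \<in> parcs G}. (#) u ` walks G n y v)"
  then obtain y q where "p = u # q" "(u, y) \<in> parcs G" and q: "q \<in> walks G n y v"
    by auto
  moreover have "u \<in> pverts G"
    using pair_wf_digraph.arc_fst_in_verts[OF assms \<open>(u, y) \<in> parcs G\<close>] by simp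
  moreover have "q \<noteq> []"
    using q by (auto simp: walks_def vwalk_def)
  ultimately show "p \<in> walks G (Suc n) u v"
    using q by (auto simp: walks_def vwalk_def Suc_le_eq)
qed

lemma markov_weight_Cons:
  "p \<noteq> [] \<Longrightarrow> markov_weight w (u # p) = w (u, hd p) * markov_weight w p"
  by (simp add: markov_weight_def)

lemma sum_markov_weight_walks_Suc:
  assumes "pair_fin_digraph G"
  shows "(\<Sum>p\<in>walks G (Suc n) u v. markov_weight w p) =
    (\<Sum>y\<in>{y. (u, y) \<in> parcs G}. w (u, y) * (\<Sum>p\<in>walks G n y v. markov_weight w p))"
proof -
  interpret pair_fin_digraph G by fact
  have "{y. (u, y) \<in> parcs G} \<subseteq> pverts G"
    using arc_snd_in_verts by fastforce
  then have fin: "finite {y. (u, y) \<in> parcs G}"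
    using pair_finite_verts finite_subset by blast
  have "(\<Sum>p\<in>walks G (Suc n) u v. markov_weight w p) =
      (\<Sum>y\<in>{y. (u, y) \<in> parcs G}. \<Sum>p\<in>(#) u ` walks G n y v. markov_weight w p)"
    unfolding walks_Suc[OF pair_wf_digraph_axioms]
    \<comment> \<open>The second vertex of a walk determines the summand that it belongs to.\<close>
    by (intro sum.UNION_disjoint fin ballI impI finite_imageI finite_walks assms)
      (auto simp: walks_def)
  also have "\<dots> = (\<Sum>y\<in>{y. (u, y) \<in> parcs G}. \<Sum>p\<in>walks G n y v. markov_weight w (u # p))"
    by (simp add: sum.reindex)
  also have "\<dots> = (\<Sum>y\<in>{y. (u, y) \<in> parcs G}. \<Sum>p\<in>walks G n y v. w (u, y) * markov_weight w p)"
    by (intro sum.cong refl) (auto simp: walks_def vwalk_def markov_weight_Cons)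
  finally show ?thesis
    by (simp add: sum_distrib_left)
qed

lemma linear_funpow: "linear L \<Longrightarrow> linear (L ^^ n)" for L :: "'a::real_vector \<Rightarrow> 'a"
  by (induction n) (simp_all add: linear_id linear_compose)

lemma independent_sum_eqD:
  fixes e :: "'i \<Rightarrow> 'a::real_vector"
  assumes "finite I" "inj_on e I" "independent (e ` I)"
    and "(\<Sum>i\<in>I. a i *\<^sub>R e i) = (\<Sum>i\<in>I. b i *\<^sub>R e i)" "j \<in> I"
  shows "a j = b j"
proof -
  define c where "c v = a (the_inv_into I e v) - b (the_inv_into I e v)" for v
  have c: "c (e i) = a i - b i" if "i \<in> I" for i
    using that assms(2) by (simp add: c_def the_inv_into_f_f)
  have "(\<Sum>v\<in>e ` I. c v *\<^sub>R v) = (\<Sum>i\<in>I. (a i - b i) *\<^sub>R e i)"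
    using assms(2) by (simp add: sum.reindex c)
  also have "\<dots> = 0"
    using assms(4) by (simp add: scaleR_diff_left sum_subtractf)
  finally have "c (e j) = 0"
    using assms(1,3,5) independentD[OF assms(3), of "e ` I" c "e j"] by simp
  then show ?thesis
    using c[OF assms(5)] by simp
qed

text \<open>
  The induction peels the first application of \<open>L\<close> off \<open>L ^^ Suc n\<close>, rather than the last one,
  because the walks are peeled at their first arc.
\<close>

lemma evolution_operator_funpow:
  assumes "pair_fin_digraph G" "bij_betw x {1..r} (pverts G)"
    and alg: "evolution_algebra G w r x e mul" and op: "evolution_operator r e mul L"
    and "i \<in> {1..r}"
  shows "(L ^^ n) (e i) = (\<Sum>j=1..r. (\<Sum>p\<in>walks G n (x i) (x j). markov_weight w p) *\<^sub>R e j)"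
  using \<open>i \<in> {1..r}\<close>
proof (induction n arbitrary: i)
  case 0
  have "(\<Sum>p\<in>walks G 0 (x i) (x j). markov_weight w p) = (if i = j then 1 else 0)"
    if "j \<in> {1..r}" for j
    using that 0 assms(2)
    by (auto simp: walks_0 markov_weight_def bij_betw_def inj_on_eq_iff)
  then have "(\<Sum>j=1..r. (\<Sum>p\<in>walks G 0 (x i) (x j). markov_weight w p) *\<^sub>R e j) =
      (\<Sum>j=1..r. if i = j then e j else 0)"
    by (intro sum.cong) auto
  also have "\<dots> = e i"
    using 0 by simp
  finally show ?case by simp
next
  case (Suc n)
  interpret pair_fin_digraph G by fact
  let ?W = "\<lambda>n u v. \<Sum>p\<in>walks G n u v. markov_weight w p"
  let ?K = "{k \<in> {1..r}. (x i, x k) \<in> parcs G}"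
  have lin: "linear (L ^^ n)"
    using op by (auto simp: evolution_operator_def intro: linear_funpow)
  have bij: "bij_betw x ?K {y. (x i, y) \<in> parcs G}"
  proof -
    have "y \<in> x ` {1..r}" if "(x i, y) \<in> parcs G" for y
      using assms(2) arc_snd_in_verts[OF that] by (auto simp: bij_betw_def)
    then have "x ` ?K = {y. (x i, y) \<in> parcs G}"
      by blast
    then show ?thesis
      using assms(2) by (auto simp: bij_betw_def intro: inj_on_subset)
  qed
  have W: "?W (Suc n) (x i) v = (\<Sum>k\<in>?K. w (x i, x k) * ?W n (x k) v)" for v
    unfolding sum_markov_weight_walks_Suc[OF assms(1)]
    by (rule sum.reindex_bij_betw[OF bij, symmetric])
  have "L (e i) = (\<Sum>k\<in>?K. w (x i, x k) *\<^sub>R e k)"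
    using alg op Suc.prems by (auto simp: evolution_algebra_def evolution_operator_def)
  then have "(L ^^ Suc n) (e i) = (\<Sum>k\<in>?K. w (x i, x k) *\<^sub>R (L ^^ n) (e k))"
    by (simp add: funpow_Suc_right linear_sum[OF lin] linear_scale[OF lin] del: funpow.simps)
  also have "\<dots> = (\<Sum>k\<in>?K. \<Sum>j=1..r. (w (x i, x k) * ?W n (x k) (x j)) *\<^sub>R e j)"
    by (intro sum.cong refl) (simp add: Suc.IH scaleR_sum_right)
  also have "\<dots> = (\<Sum>j=1..r. ?W (Suc n) (x i) (x j) *\<^sub>R e j)"
    unfolding W by (subst sum.swap) (simp add: scaleR_sum_left)
  finally show ?case .
qed

theorem theorem2p11:
  fixes G :: "'v pair_pre_digraph" and w :: "'v \<times> 'v \<Rightarrow> real"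
    and r n :: nat and x :: "nat \<Rightarrow> 'v"
    and e :: "nat \<Rightarrow> 'a::real_vector" and mul :: "'a \<Rightarrow> 'a \<Rightarrow> 'a"
    and L :: "'a \<Rightarrow> 'a" and N :: "nat \<Rightarrow> nat \<Rightarrow> real"
  assumes "pair_fin_digraph G"
    and "bij_betw x {1..r} (pverts G)"
    and "evolution_algebra G w r x e mul"
    and "evolution_operator r e mul L"
    and "n \<ge> 1"
    and "\<And>i. i \<in> {1..r} \<Longrightarrow> (L ^^ n) (e i) = (\<Sum>j=1..r. N i j *\<^sub>R e j)"
  shows "\<forall>i\<in>{1..r}. \<forall>j\<in>{1..r}. N i j = (\<Sum>p\<in>walks G n (x i) (x j). markov_weight w p)"
proof (intro ballI)
  fix i j
  assume i: "i \<in> {1..r}" and j: "j \<in> {1..r}"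
  let ?W = "\<lambda>j. \<Sum>p\<in>walks G n (x i) (x j). markov_weight w p"
  have eq: "(\<Sum>j=1..r. N i j *\<^sub>R e j) = (\<Sum>j=1..r. ?W j *\<^sub>R e j)"
    using assms(6)[OF i] evolution_operator_funpow[OF assms(1-4) i] by metis
  have "inj_on e {1..r}" "independent (e ` {1..r})"
    using assms(3) by (auto simp: evolution_algebra_def)
  from independent_sum_eqD[OF finite_atLeastAtMost this eq j] show "N i j = ?W j" .
qed

end
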